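(* Let $K$ be a field, $S=K[x_1,\ldots,x_n]$, and let $M$ be a finitely generated graded $S$-module admitting linear quotients with respect to a system of homogeneous generators $f_1,\ldots,f_m$, and assume that $\deg f_1\leq \deg f_2\leq\cdots\leq \deg f_m$. Then $M$ is componentwise linear.
   Context: $S=K[x_1,\ldots,x_n]$ has the standard grading. Given a system of generators $f_1,\ldots,f_m$ of an $S$-module $M$, put $I_j=(f_1,\ldots,f_{j-1}):f_j=\{g\in S: gf_j\in(f_1,\ldots,f_{j-1})\}$ for $1\le j\le m$, where $(f_1,\ldots,f_{j-1})$ is the submodule of $M$ generated by $f_1,\ldots,f_{j-1}$ (zero for $j=1$). $M$ has linear quotients with respect to $f_1,\ldots,f_m$ if for every $1\le j\le m$ the ideal $I_j$ is either equal to $S$ or is generated by linear forms (the zero ideal is allowed). The generators need not be minimal. For a graded module $M$ and an integer $k$, $M_{\langle k\rangle}$ denotes the submodule of $M$ generated by all elements of $M$ of degree $k$. $M$ is componentwise linear if $M_{\langle k\rangle}$ has a linear resolution for every $k$ (the zero module is regarded as having a linear resolution). *)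

theory Defs
  imports Complex_Main "HOL-Library.Poly_Mapping"
begin

text \<open>
  Polynomials over \<open>'k\<close> whose variables are the elements of \<open>'x\<close>: finitely supported maps
  from exponent vectors to coefficients. For a finite type \<open>'x\<close> with \<open>n\<close> elements this is
  \<open>S = K[x\<^sub>1, \<dots>, x\<^sub>n]\<close>; the ring is regarded as a module over itself via \<open>(*)\<close>, so that
  \<open>module.span (*) L\<close> is the ideal generated by \<open>L\<close>.
\<close>

type_synonym ('x, 'k) mpoly = "('x \<Rightarrow>\<^sub>0 nat) \<Rightarrow>\<^sub>0 'k"

definition monomial_degree :: "('x::finite \<Rightarrow>\<^sub>0 nat) \<Rightarrow> nat" where
  "monomial_degree t = (\<Sum>x\<in>UNIV. Poly_Mapping.lookup t x)"

text \<open>The component \<open>S\<^sub>d\<close>; it contains \<open>0\<close> and is \<open>{0}\<close> for negative \<open>d\<close>.\<close>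

definition homogeneous_polys :: "int \<Rightarrow> ('x::finite, 'k::field) mpoly set" where
  "homogeneous_polys d = {p. \<forall>t\<in>Poly_Mapping.keys p. int (monomial_degree t) = d}"

abbreviation linear_forms :: "('x::finite, 'k::field) mpoly set" where
  "linear_forms \<equiv> homogeneous_polys 1"

definition variable :: "'x \<Rightarrow> ('x, 'k::field) mpoly" where
  "variable x = Poly_Mapping.single (Poly_Mapping.single x 1) 1"

definition graded_maximal_ideal :: "('x::finite, 'k::field) mpoly set" where
  "graded_maximal_ideal = module.span (*) (range variable)"

text \<open>
  A module over \<open>S\<close> with underlying type \<open>'m\<close>, together with a grading
  \<open>M = \<Oplus>\<^bsub>d \<in> \<int>\<^esub> M\<^sub>d\<close> by additive subgroups such that \<open>S\<^sub>e M\<^sub>d \<subseteq> M\<^bsub>e + d\<^esub>\<close>.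
  Closure under negation follows from \<open>S\<^sub>0 M\<^sub>d \<subseteq> M\<^sub>d\<close>.
\<close>

locale graded_module = module scale
  for scale :: "('x::finite, 'k::field) mpoly \<Rightarrow> 'm::ab_group_add \<Rightarrow> 'm" +
  fixes component :: "int \<Rightarrow> 'm set"
  assumes zero_in_component: "0 \<in> component d"
    and add_in_component: "u \<in> component d \<Longrightarrow> v \<in> component d \<Longrightarrow> u + v \<in> component d"
    and scale_in_component:
      "p \<in> homogeneous_polys e \<Longrightarrow> v \<in> component d \<Longrightarrow> scale p v \<in> component (e + d)"
    and direct_sum_decomposition:
      "\<exists>!c. finite {d. c d \<noteq> 0} \<and> (\<forall>d. c d \<in> component d) \<and> v = (\<Sum>d | c d \<noteq> 0. c d)"

definition colon_ideal ::
  "(('x::finite, 'k::field) mpoly \<Rightarrow> 'm::ab_group_add \<Rightarrow> 'm) \<Rightarrow> (nat \<Rightarrow> 'm) \<Rightarrow> nat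
    \<Rightarrow> ('x, 'k) mpoly set" where
  "colon_ideal scale f j = {g. scale g (f j) \<in> module.span scale (f ` {1..<j})}"

definition generated_by_linear_forms :: "('x::finite, 'k::field) mpoly set \<Rightarrow> bool" where
  "generated_by_linear_forms I \<longleftrightarrow> (\<exists>L \<subseteq> linear_forms. I = module.span (*) L)"

definition has_linear_quotients ::
  "(('x::finite, 'k::field) mpoly \<Rightarrow> 'm::ab_group_add \<Rightarrow> 'm) \<Rightarrow> (nat \<Rightarrow> 'm) \<Rightarrow> nat \<Rightarrow> bool" where
  "has_linear_quotients scale f m \<longleftrightarrow>
     module.span scale (f ` {1..m}) = UNIV \<and>
     (\<forall>j\<in>{1..m}. colon_ideal scale f j = UNIV \<or> generated_by_linear_forms (colon_ideal scale f j))"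

text \<open>
  The free module \<open>S\<^sup>b\<close> consists of the coordinate vectors vanishing outside \<open>{..<b}\<close>.
  A homomorphism out of \<open>S\<^sup>b\<close> is given by the images of the basis vectors:
  \<open>free_eval\<close> for an arbitrary target module, \<open>free_map\<close> for the target \<open>S\<^sup>c\<close>, where
  \<open>A l\<close> lists the coordinates of the image of the \<open>l\<close>-th basis vector.
\<close>

definition free_module :: "nat \<Rightarrow> (nat \<Rightarrow> ('x, 'k::field) mpoly) set" where
  "free_module b = {v. \<forall>j\<ge>b. v j = 0}"

definition free_eval ::
  "(('x::finite, 'k::field) mpoly \<Rightarrow> 'm::ab_group_add \<Rightarrow> 'm) \<Rightarrow> nat \<Rightarrow> (nat \<Rightarrow> 'm)
    \<Rightarrow> (nat \<Rightarrow> ('x, 'k) mpoly) \<Rightarrow> 'm" where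
  "free_eval scale b g v = (\<Sum>l<b. scale (v l) (g l))"

definition free_map ::
  "nat \<Rightarrow> nat \<Rightarrow> (nat \<Rightarrow> nat \<Rightarrow> ('x::finite, 'k::field) mpoly)
    \<Rightarrow> (nat \<Rightarrow> ('x, 'k) mpoly) \<Rightarrow> (nat \<Rightarrow> ('x, 'k) mpoly)" where
  "free_map b c A v = (\<lambda>j. if j < c then \<Sum>l<b. v l * A l j else 0)"

text \<open>
  A graded free resolution
  \<open>\<cdots> \<rightarrow> F\<^sub>2 \<rightarrow> F\<^sub>1 \<rightarrow> F\<^sub>0 \<rightarrow> N \<rightarrow> 0\<close> of a graded submodule \<open>N\<close> by free modules
  \<open>F\<^sub>i = \<Oplus>\<^bsub>j < b i\<^esub> S(- a i j)\<close> of finite rank. The augmentation \<open>F\<^sub>0 \<rightarrow> N\<close> is given by \<open>g\<close>, the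
  differential \<open>F\<^bsub>i+1\<^esub> \<rightarrow> F\<^sub>i\<close> by the matrix \<open>D i\<close>. As the \<open>l\<close>-th basis vector of \<open>F\<^sub>i\<close> has
  degree \<open>a i l\<close>, the first two conditions say that all maps preserve degrees; the remaining
  three are exactness at \<open>N\<close>, at \<open>F\<^sub>0\<close> and at \<open>F\<^bsub>i+1\<^esub>\<close>. Ranks may be \<open>0\<close>.
\<close>

definition graded_free_resolution ::
  "(('x::finite, 'k::field) mpoly \<Rightarrow> 'm::ab_group_add \<Rightarrow> 'm) \<Rightarrow> (int \<Rightarrow> 'm set) \<Rightarrow> 'm set
    \<Rightarrow> (nat \<Rightarrow> nat) \<Rightarrow> (nat \<Rightarrow> nat \<Rightarrow> int) \<Rightarrow> (nat \<Rightarrow> 'm)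
    \<Rightarrow> (nat \<Rightarrow> nat \<Rightarrow> nat \<Rightarrow> ('x, 'k) mpoly) \<Rightarrow> bool" where
  "graded_free_resolution scale component N b a g D \<longleftrightarrow>
     (\<forall>l<b 0. g l \<in> component (a 0 l)) \<and>
     (\<forall>i. \<forall>l<b (Suc i). \<forall>j<b i. D i l j \<in> homogeneous_polys (a (Suc i) l - a i j)) \<and>
     free_eval scale (b 0) g ` free_module (b 0) = N \<and>
     free_map (b 1) (b 0) (D 0) ` free_module (b 1)
       = {v \<in> free_module (b 0). free_eval scale (b 0) g v = 0} \<and>
     (\<forall>i. free_map (b (Suc (Suc i))) (b (Suc i)) (D (Suc i)) ` free_module (b (Suc (Suc i)))
       = {v \<in> free_module (b (Suc i)). free_map (b (Suc i)) (b i) (D i) v = (\<lambda>_. 0)})"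

text \<open>Minimality: the image of \<open>F\<^bsub>i+1\<^esub>\<close> lies in \<open>\<mm> F\<^sub>i\<close> for every \<open>i\<close>.\<close>

definition minimal_graded_free_resolution ::
  "(('x::finite, 'k::field) mpoly \<Rightarrow> 'm::ab_group_add \<Rightarrow> 'm) \<Rightarrow> (int \<Rightarrow> 'm set) \<Rightarrow> 'm set
    \<Rightarrow> (nat \<Rightarrow> nat) \<Rightarrow> (nat \<Rightarrow> nat \<Rightarrow> int) \<Rightarrow> (nat \<Rightarrow> 'm)
    \<Rightarrow> (nat \<Rightarrow> nat \<Rightarrow> nat \<Rightarrow> ('x, 'k) mpoly) \<Rightarrow> bool" where
  "minimal_graded_free_resolution scale component N b a g D \<longleftrightarrow>
     graded_free_resolution scale component N b a g D \<and>
     (\<forall>i. \<forall>l<b (Suc i). \<forall>j<b i. D i l j \<in> graded_maximal_ideal)"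

text \<open>
  Linear resolution: for some \<open>d\<close>, the free module in homological degree \<open>i\<close> of the minimal
  graded free resolution is a sum of copies of \<open>S(- d - i)\<close>. The zero module qualifies, with
  all ranks \<open>0\<close>.
\<close>

definition has_linear_resolution ::
  "(('x::finite, 'k::field) mpoly \<Rightarrow> 'm::ab_group_add \<Rightarrow> 'm) \<Rightarrow> (int \<Rightarrow> 'm set) \<Rightarrow> 'm set \<Rightarrow> bool"
  where
  "has_linear_resolution scale component N \<longleftrightarrow>
     (\<exists>d b a g D. minimal_graded_free_resolution scale component N b a g D \<and>
        (\<forall>i. \<forall>j<b i. a i j = d + int i))"

definition degree_submodule ::
  "(('x::finite, 'k::field) mpoly \<Rightarrow> 'm::ab_group_add \<Rightarrow> 'm) \<Rightarrow> (int \<Rightarrow> 'm set) \<Rightarrow> int \<Rightarrow> 'm set"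
  where
  "degree_submodule scale component k = module.span scale (component k)"

definition componentwise_linear ::
  "(('x::finite, 'k::field) mpoly \<Rightarrow> 'm::ab_group_add \<Rightarrow> 'm) \<Rightarrow> (int \<Rightarrow> 'm set) \<Rightarrow> bool" where
  "componentwise_linear scale component \<longleftrightarrow>
     (\<forall>k. has_linear_resolution scale component (degree_submodule scale component k))"

end

theory Submission
  imports Defs "HOL-Library.Function_Algebras"
begin

text \<open>
  Call a finite list of elements of one degree \<open>k\<close> linear if the colon ideal of each element with
  respect to the preceding ones is generated by linear forms. The proof has two independent halves.

  A submodule generated by a linear list has a linear resolution
  (\<open>linear_quotient_list_resolution\<close>). The reason is that the relations among a linear list are again
  generated by a linear list, consisting of vectors of linear forms (\<open>syzygies_generated\<close>). The relations
  among the first \<open>j\<close> elements, modulo those among the first \<open>j - 1\<close>, form a copy of the \<open>j\<close>-th colon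
  ideal \<open>(l\<^sub>1, \<dots>, l\<^sub>r)\<close>, where the \<open>l\<^sub>s\<close> may be taken linearly independent. Then the
  colon ideal of \<open>l\<^sub>s\<close> with respect to \<open>l\<^sub>1, \<dots>, l\<^bsub>s-1\<^esub>\<close> is \<open>(l\<^sub>1, \<dots>, l\<^bsub>s-1\<^esub>)\<close>, because independent
  linear forms are a regular sequence
  (\<open>linear_form_nonzerodivisor_modulo\<close>). Syzygies can therefore be taken indefinitely, and every
  differential has linear entries.

  Each \<open>M\<^bsub>\<langle>k\<rangle>\<^esub>\<close> is generated by a linear list (\<open>truncation_generators\<close> and
  \<open>truncation_eq_degree_submodule\<close>). It is filtered by the sums of the \<open>\<mm>\<^bsup>k - deg i\<^esup> f\<^sub>i\<close> over \<open>i \<le> j\<close>, for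
  the \<open>j\<close> with \<open>deg j \<le> k\<close>. As the degrees do not decrease, \<open>f\<^sub>1, \<dots>, f\<^sub>j\<close> all have degree at most \<open>k\<close>,
  and such a sum is the part of \<open>(f\<^sub>1, \<dots>, f\<^sub>j)\<close> in degrees at least \<open>k\<close>. The quotient of two successive
  sums is therefore zero or a truncation of a polynomial ring \<open>S / (L)\<close>, with a set \<open>L\<close> of linear
  forms. The truncation of \<open>S / (L)\<close> in degrees at least \<open>e\<close> is generated by a linear list, by induction on
  \<open>e\<close> and on the number of variables outside \<open>(L)\<close>: multiplication by such a variable \<open>z\<close> embeds
  the truncation in degrees at least \<open>e - 1\<close> into it, with the truncation of \<open>S / (L, z)\<close> in degrees at
  least \<open>e\<close> as quotient (\<open>truncated_cyclic_extension\<close>).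
\<close>

section \<open>Polynomials as sums of terms\<close>

abbreviation const :: "'k \<Rightarrow> ('x, 'k::field) mpoly" where
  "const c \<equiv> Poly_Mapping.single 0 c"

interpretation poly_ideal: module "(*) :: ('x, 'k::field) mpoly \<Rightarrow> ('x, 'k) mpoly \<Rightarrow> ('x, 'k) mpoly"
  by standard (simp_all add: algebra_simps)

abbreviation ideal :: "('x, 'k::field) mpoly set \<Rightarrow> ('x, 'k) mpoly set" where
  "ideal \<equiv> module.span (*)"

lemma sum_of_terms: "p = (\<Sum>t\<in>Poly_Mapping.keys p. Poly_Mapping.single t (Poly_Mapping.lookup p t))"
  by (rule poly_mapping_eqI) (auto simp: lookup_sum lookup_single when_def in_keys_iff)

lemma variable_power: "variable x ^ n = Poly_Mapping.single (Poly_Mapping.single x n) 1"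
proof (induction n)
  case (Suc n)
  then show ?case by (simp add: variable_def mult_single flip: single_add)
qed simp

lemma monomial_eq_prod_variables:
  "(Poly_Mapping.single t 1 :: ('x::finite, 'k::field) mpoly)
    = (\<Prod>x\<in>UNIV. variable x ^ Poly_Mapping.lookup t x)"
proof -
  have "(\<Prod>x\<in>A. (variable x :: ('x, 'k) mpoly) ^ Poly_Mapping.lookup t x)
      = Poly_Mapping.single (\<Sum>x\<in>A. Poly_Mapping.single x (Poly_Mapping.lookup t x)) 1" for A
    by (induction A rule: infinite_finite_induct) (simp_all add: variable_power mult_single)
  moreover have "(\<Sum>x\<in>UNIV. Poly_Mapping.single x (Poly_Mapping.lookup t x)) = t"
    by (rule poly_mapping_eqI) (simp add: lookup_sum lookup_single when_def)
  ultimately show ?thesis by simp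
qed

lemma term_eq_const_times_monomial:
  "Poly_Mapping.single t c = const c * Poly_Mapping.single t 1"
  by (simp add: mult_single)

lemma mpoly_induct [case_names const variable add mult]:
  fixes p :: "('x::finite, 'k::field) mpoly"
  assumes const: "\<And>c. P (const c)" and variable: "\<And>x. P (variable x)"
    and add: "\<And>p q. P p \<Longrightarrow> P q \<Longrightarrow> P (p + q)" and mult: "\<And>p q. P p \<Longrightarrow> P q \<Longrightarrow> P (p * q)"
  shows "P p"
proof -
  have one: "P 1" using const[of 1] by simp
  have zero: "P 0" using const[of 0] by simp
  have power: "P (variable x ^ n)" for x n
    by (induction n) (simp_all add: one variable mult)
  have "P (\<Prod>x\<in>A. variable x ^ n x)" for A n
    by (induction A rule: infinite_finite_induct) (simp_all add: one power mult)
  then have "P (Poly_Mapping.single t c)" for t c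
    by (metis const mult monomial_eq_prod_variables term_eq_const_times_monomial)
  then have "P (\<Sum>t\<in>A. Poly_Mapping.single t (c t))" for A c
    by (induction A rule: infinite_finite_induct) (simp_all add: zero add)
  then show ?thesis by (metis sum_of_terms)
qed

section \<open>Substitution homomorphisms\<close>

definition substitute :: "('x::finite \<Rightarrow> ('x, 'k::field) mpoly) \<Rightarrow> ('x, 'k) mpoly \<Rightarrow> ('x, 'k) mpoly" where
  "substitute h p =
     (\<Sum>t\<in>Poly_Mapping.keys p. const (Poly_Mapping.lookup p t) * (\<Prod>x\<in>UNIV. h x ^ Poly_Mapping.lookup t x))"

lemma substitute_add: "substitute h (p + q) = substitute h p + substitute h q"
  unfolding substitute_def
  by (rule setsum_keys_plus_distrib) (simp_all add: single_add algebra_simps)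

lemma substitute_zero: "substitute h 0 = 0"
  by (simp add: substitute_def)

lemma substitute_sum: "substitute h (sum F A) = (\<Sum>i\<in>A. substitute h (F i))"
  by (induction A rule: infinite_finite_induct) (simp_all add: substitute_add substitute_zero)

lemma substitute_term:
  "substitute h (Poly_Mapping.single t c) = const c * (\<Prod>x\<in>UNIV. h x ^ Poly_Mapping.lookup t x)"
  by (simp add: substitute_def)

lemma substitute_mult:
  fixes h :: "'x::finite \<Rightarrow> ('x, 'k::field) mpoly"
  shows "substitute h (p * q) = substitute h p * substitute h q"
proof -
  have single: "substitute h (Poly_Mapping.single s a * Poly_Mapping.single t b)
    = substitute h (Poly_Mapping.single s a) * substitute h (Poly_Mapping.single t b)" for s t a b
    unfolding substitute_term mult_single lookup_add power_add prod.distrib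
    using mult_single[of "0 :: 'x \<Rightarrow>\<^sub>0 nat" a 0 b, symmetric] by (simp only: add_0_left mult_ac)
  obtain A c where p: "p = (\<Sum>t\<in>A. Poly_Mapping.single t (c t))" using sum_of_terms by blast
  obtain B d where q: "q = (\<Sum>t\<in>B. Poly_Mapping.single t (d t))" using sum_of_terms by blast
  show ?thesis
    unfolding p q sum_product substitute_sum single ..
qed

lemma substitute_const: "substitute h (const c) = const c"
  by (simp add: substitute_term)

lemma substitute_variable: "substitute h (variable y) = h y"
proof -
  have "(\<Prod>x\<in>UNIV. h x ^ Poly_Mapping.lookup (Poly_Mapping.single y (1::nat)) x)
      = (\<Prod>x\<in>UNIV. if x = y then h x else 1)"
    by (rule prod.cong) (auto simp: lookup_single when_def)
  then show ?thesis by (simp add: variable_def substitute_term)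
qed

section \<open>Homogeneous components of polynomials\<close>

lemma homogeneous_zero [simp]: "0 \<in> homogeneous_polys d"
  by (simp add: homogeneous_polys_def)

lemma homogeneous_add:
  "p \<in> homogeneous_polys d \<Longrightarrow> q \<in> homogeneous_polys d \<Longrightarrow> p + q \<in> homogeneous_polys d"
  unfolding homogeneous_polys_def using keys_add[of p q] by blast

lemma homogeneous_sum:
  "(\<And>i. i \<in> A \<Longrightarrow> F i \<in> homogeneous_polys d) \<Longrightarrow> sum F A \<in> homogeneous_polys d"
  by (induction A rule: infinite_finite_induct) (simp_all add: homogeneous_add)

lemma monomial_degree_add: "monomial_degree (s + t) = monomial_degree s + monomial_degree t"
  by (simp add: monomial_degree_def lookup_add sum.distrib)

lemma homogeneous_mult:
  "p \<in> homogeneous_polys d \<Longrightarrow> q \<in> homogeneous_polys e \<Longrightarrow> p * q \<in> homogeneous_polys (d + e)"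
  unfolding homogeneous_polys_def using keys_mult[of p q]
  by (fastforce simp: monomial_degree_add)

lemma homogeneous_const [simp]: "const c \<in> homogeneous_polys 0"
  by (simp add: homogeneous_polys_def monomial_degree_def)

lemma homogeneous_uminus: "p \<in> homogeneous_polys d \<Longrightarrow> - p \<in> homogeneous_polys d"
  using homogeneous_mult[OF homogeneous_const[of "- 1"], of p d] by (simp add: single_uminus)

lemma monomial_degree_single [simp]: "monomial_degree (Poly_Mapping.single x n) = n"
  by (simp add: monomial_degree_def lookup_single when_def)

lemma variable_linear [simp]: "variable x \<in> linear_forms"
  by (simp add: variable_def homogeneous_polys_def)

definition hcomp :: "int \<Rightarrow> ('x::finite, 'k::field) mpoly \<Rightarrow> ('x, 'k) mpoly" where
  "hcomp d p = Poly_Mapping.mapp (\<lambda>t c. if int (monomial_degree t) = d then c else 0) p"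

lemma lookup_hcomp:
  "Poly_Mapping.lookup (hcomp d p) t
    = (if int (monomial_degree t) = d then Poly_Mapping.lookup p t else 0)"
  by (auto simp: hcomp_def lookup_mapp in_keys_iff when_def)

lemma hcomp_homogeneous [simp]: "hcomp d p \<in> homogeneous_polys d"
  by (auto simp: homogeneous_polys_def in_keys_iff lookup_hcomp split: if_splits)

lemma hcomp_add: "hcomp d (p + q) = hcomp d p + hcomp d q"
  by (rule poly_mapping_eqI) (simp add: lookup_hcomp lookup_add)

lemma hcomp_zero [simp]: "hcomp d 0 = 0"
  by (rule poly_mapping_eqI) (simp add: lookup_hcomp)

lemma hcomp_sum: "hcomp d (sum F A) = (\<Sum>i\<in>A. hcomp d (F i))"
  by (induction A rule: infinite_finite_induct) (simp_all add: hcomp_add)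

lemma hcomp_of_homogeneous:
  "p \<in> homogeneous_polys e \<Longrightarrow> hcomp d p = (if d = e then p else 0)"
  by (rule poly_mapping_eqI)
    (auto simp: lookup_hcomp homogeneous_polys_def in_keys_iff)

definition degrees :: "('x::finite, 'k::field) mpoly \<Rightarrow> int set" where
  "degrees p = (\<lambda>t. int (monomial_degree t)) ` Poly_Mapping.keys p"

lemma finite_degrees [simp]: "finite (degrees p)"
  by (simp add: degrees_def)

lemma hcomp_notin_degrees: "d \<notin> degrees p \<Longrightarrow> hcomp d p = 0"
  by (rule poly_mapping_eqI) (auto simp: lookup_hcomp degrees_def in_keys_iff)

lemma sum_hcomp:
  assumes "finite D" "degrees p \<subseteq> D" shows "(\<Sum>d\<in>D. hcomp d p) = p"
proof (rule poly_mapping_eqI)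
  fix t
  have "(\<Sum>d\<in>D. Poly_Mapping.lookup (hcomp d p) t) =
    (if int (monomial_degree t) \<in> D then Poly_Mapping.lookup p t else 0)"
    using assms(1) by (simp add: lookup_hcomp)
  also have "\<dots> = Poly_Mapping.lookup p t"
    using assms(2) by (fastforce simp: degrees_def in_keys_iff)
  finally show "Poly_Mapping.lookup (\<Sum>d\<in>D. hcomp d p) t = Poly_Mapping.lookup p t"
    by (simp add: lookup_sum)
qed

text \<open>
  Multiplying by a homogeneous polynomial only shifts degrees, so taking components commutes
  with it up to that shift. This is how every homogeneity argument below is carried out.
\<close>

lemma hcomp_mult:
  assumes "q \<in> homogeneous_polys e"
  shows "hcomp d (p * q) = hcomp (d - e) p * q"
proof -
  let ?D = "insert (d - e) (degrees p)"
  have "hcomp d (p * q) = hcomp d (\<Sum>s\<in>?D. hcomp s p * q)"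
    by (subst sum_distrib_right[symmetric], subst sum_hcomp) auto
  also have "\<dots> = (\<Sum>s\<in>?D. if s = d - e then hcomp s p * q else 0)"
    unfolding hcomp_sum
    by (rule sum.cong[OF refl])
      (auto simp: hcomp_of_homogeneous[OF homogeneous_mult[OF hcomp_homogeneous assms]])
  also have "\<dots> = hcomp (d - e) p * q" by simp
  finally show ?thesis .
qed

lemma hcomp_in_ideal:
  assumes L: "L \<subseteq> homogeneous_polys e" and p: "p \<in> ideal L"
  shows "hcomp d p \<in> ideal L"
  using p
proof (induction rule: poly_ideal.span_induct_alt)
  case base
  then show ?case by (simp add: poly_ideal.span_zero)
next
  case (step c l y)
  have "hcomp d (c * l) = hcomp (d - e) c * l" using hcomp_mult L step(1) by blast
  then show ?case using step
    by (auto simp: hcomp_add intro: poly_ideal.span_add poly_ideal.span_scale poly_ideal.span_base)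
qed

section \<open>Ideals generated by linear forms\<close>

lemma monomial_degree_one:
  assumes "monomial_degree t = 1" shows "\<exists>x. t = Poly_Mapping.single x 1"
proof -
  obtain x where "Poly_Mapping.lookup t x = 1" "\<forall>y. x \<noteq> y \<longrightarrow> Poly_Mapping.lookup t y = 0"
    using assms unfolding monomial_degree_def by (subst (asm) sum_eq_1_iff) auto
  then have "t = Poly_Mapping.single x 1"
    by (intro poly_mapping_eqI) (auto simp: lookup_single when_def)
  then show ?thesis ..
qed

lemma linear_form_expansion:
  fixes l :: "('x::finite, 'k::field) mpoly"
  assumes "l \<in> linear_forms"
  shows "l = (\<Sum>x\<in>UNIV. const (Poly_Mapping.lookup l (Poly_Mapping.single x 1)) * variable x)"
proof (rule poly_mapping_eqI)
  fix t :: "'x \<Rightarrow>\<^sub>0 nat"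
  have rhs: "Poly_Mapping.lookup (\<Sum>x\<in>UNIV. const (Poly_Mapping.lookup l (Poly_Mapping.single x 1)) * variable x) t
     = (\<Sum>x\<in>UNIV. if Poly_Mapping.single x 1 = t then Poly_Mapping.lookup l t else 0)"
    unfolding lookup_sum by (rule sum.cong) (auto simp: variable_def mult_single lookup_single when_def)
  show "Poly_Mapping.lookup l t = Poly_Mapping.lookup
    (\<Sum>x\<in>UNIV. const (Poly_Mapping.lookup l (Poly_Mapping.single x 1)) * variable x) t"
  proof (cases "\<exists>x. t = Poly_Mapping.single x 1")
    case True
    then obtain y where y: "t = Poly_Mapping.single y 1" ..
    have "Poly_Mapping.single x 1 = t \<longleftrightarrow> x = y" for x
      unfolding y by (metis lookup_single_eq lookup_single_not_eq zero_neq_one)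
    then show ?thesis unfolding rhs by simp
  next
    case False
    then have "monomial_degree t \<noteq> 1" using monomial_degree_one by blast
    then have "Poly_Mapping.lookup l t = 0"
      using assms by (auto simp: homogeneous_polys_def in_keys_iff)
    moreover have "\<And>x. Poly_Mapping.single x 1 \<noteq> t" using False by blast
    ultimately show ?thesis unfolding rhs by simp
  qed
qed

lemma lookup_monomial_mult:
  fixes p :: "('x::finite, 'k::field) mpoly"
  shows "Poly_Mapping.lookup (Poly_Mapping.single s 1 * p) (s + t) = Poly_Mapping.lookup p t"
proof -
  have "Poly_Mapping.single s 1 * p = (\<Sum>u\<in>Poly_Mapping.keys p. Poly_Mapping.single (s + u) (Poly_Mapping.lookup p u))"
    by (subst sum_of_terms[of p]) (simp add: sum_distrib_left mult_single)
  then show ?thesis by (simp add: lookup_sum lookup_single when_def in_keys_iff)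
qed

text \<open>
  The exponents carry no monomial order, and one variable is enough to replace it. Let \<open>y\<close>
  occur in \<open>l\<close>, and let \<open>t\<close> be a monomial of \<open>p\<close> with the largest exponent of \<open>y\<close>. In \<open>l * p\<close>
  the monomial \<open>y t\<close> can arise as \<open>x s\<close>, for a variable \<open>x \<noteq> y\<close> and a monomial \<open>s\<close> of \<open>p\<close>, only if \<open>s\<close>
  has one more factor \<open>y\<close> than \<open>t\<close>. Hence its coefficient is the nonzero product of the coefficient
  of \<open>y\<close> in \<open>l\<close> and that of \<open>t\<close> in \<open>p\<close>.
\<close>

lemma linear_form_mult_eq_zero:
  fixes l p :: "('x::finite, 'k::field) mpoly"
  assumes l: "l \<in> linear_forms" and zero: "l * p = 0" and nz: "l \<noteq> 0"
  shows "p = 0"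
proof (rule ccontr)
  assume p: "p \<noteq> 0"
  define a where "a x = Poly_Mapping.lookup l (Poly_Mapping.single x 1)" for x
  have exp: "l = (\<Sum>x\<in>UNIV. const (a x) * variable x)"
    using linear_form_expansion[OF l] by (simp add: a_def)
  obtain y where y: "a y \<noteq> 0" using nz exp by force
  have ne: "Poly_Mapping.keys p \<noteq> {}"
    using p by (metis sum.empty sum_of_terms)
  define e where "e = Max ((\<lambda>t. Poly_Mapping.lookup t y) ` Poly_Mapping.keys p)"
  have "e \<in> (\<lambda>t. Poly_Mapping.lookup t y) ` Poly_Mapping.keys p"
    unfolding e_def by (rule Max_in) (use ne in auto)
  then obtain t where t: "t \<in> Poly_Mapping.keys p" "Poly_Mapping.lookup t y = e" by auto
  have le: "Poly_Mapping.lookup s y \<le> e" if "s \<in> Poly_Mapping.keys p" for s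
    unfolding e_def by (rule Max_ge) (use that in auto)
  have coeff: "Poly_Mapping.lookup (variable x * p) (Poly_Mapping.single y 1 + t)
      = (if x = y then Poly_Mapping.lookup p t else 0)" for x
  proof (cases "x = y")
    case True
    then show ?thesis by (simp add: variable_def lookup_monomial_mult)
  next
    case False
    have "Poly_Mapping.single y 1 + t \<notin> Poly_Mapping.keys (variable x * p)"
    proof
      assume "Poly_Mapping.single y 1 + t \<in> Poly_Mapping.keys (variable x * p)"
      then obtain s where s: "s \<in> Poly_Mapping.keys p"
        "Poly_Mapping.single y 1 + t = Poly_Mapping.single x 1 + s"
        using keys_mult[of "variable x" p] by (auto simp: variable_def)
      from arg_cong[OF s(2), of "\<lambda>t. Poly_Mapping.lookup t y"] have "Poly_Mapping.lookup s y = Suc e"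
        using False t(2) by (simp add: lookup_add lookup_single when_def)
      with le[OF s(1)] show False by simp
    qed
    with False show ?thesis by (simp add: in_keys_iff)
  qed
  have scale: "Poly_Mapping.lookup (const c * q) u = c * Poly_Mapping.lookup q u"
    for c :: 'k and q :: "('x, 'k) mpoly" and u
    by (simp add: Poly_Mapping.map.rep_eq when_def flip: mult_map_scale_conv_mult)
  have "Poly_Mapping.lookup (l * p) (Poly_Mapping.single y 1 + t)
    = (\<Sum>x\<in>UNIV. a x * Poly_Mapping.lookup (variable x * p) (Poly_Mapping.single y 1 + t))"
    unfolding arg_cong[OF exp, of "\<lambda>l. l * p"] sum_distrib_right lookup_sum mult.assoc scale ..
  also have "\<dots> = a y * Poly_Mapping.lookup p t"
    unfolding coeff by (simp add: if_distrib[of "(*) _"] cong: if_cong)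
  finally show False using zero y t(1) by (simp add: in_keys_iff)
qed

text \<open>
  A maximal linearly independent subset of \<open>L\<close> over the field spans \<open>L\<close>, and it is finite because
  all linear forms lie in the span of the variables.
\<close>

lemma linear_ideal_finitely_generated:
  fixes L :: "('x::finite, 'k::field) mpoly set"
  assumes "L \<subseteq> linear_forms"
  shows "\<exists>B \<subseteq> L. finite B \<and> ideal B = ideal L"
proof -
  interpret K: vector_space "\<lambda>c (p :: ('x, 'k) mpoly). const c * p"
    by standard (simp_all add: distrib_left distrib_right single_add mult_single flip: mult.assoc)
  obtain B where B: "B \<subseteq> L" "K.independent B" "L \<subseteq> K.span B"
    by (rule K.maximal_independent_subset)
  have "L \<subseteq> K.span (range variable)"
  proof
    fix l assume "l \<in> L"
    then have "l \<in> linear_forms" using assms by blast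
    then show "l \<in> K.span (range variable)"
      by (subst linear_form_expansion) (auto intro: K.span_sum K.span_scale K.span_base)
  qed
  then have "finite B"
    using K.independent_span_bound[of "range variable" B] B finite_imageI[OF finite_UNIV] by blast
  moreover have "K.span B \<subseteq> ideal B"
  proof (rule K.span_minimal)
    show "B \<subseteq> ideal B" by (rule poly_ideal.span_superset)
    show "K.subspace (ideal B)"
      by (rule K.subspaceI)
        (auto intro: poly_ideal.span_zero poly_ideal.span_add poly_ideal.span_scale)
  qed
  then have "ideal B = ideal L"
    using B by (intro poly_ideal.span_eq[THEN iffD2]) (auto intro: poly_ideal.span_base)
  ultimately show ?thesis using B(1) by blast
qed

lemma linear_form_in_graded_maximal_ideal:
  "l \<in> linear_forms \<Longrightarrow> l \<in> graded_maximal_ideal"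
  unfolding graded_maximal_ideal_def
  by (subst linear_form_expansion) (auto intro: poly_ideal.span_sum poly_ideal.span_scale poly_ideal.span_base)

lemma substitute_linear_form:
  assumes "l \<in> linear_forms"
  shows "substitute h l = (\<Sum>x\<in>UNIV. const (Poly_Mapping.lookup l (Poly_Mapping.single x 1)) * h x)"
  by (subst linear_form_expansion[OF assms])
    (simp add: substitute_sum substitute_mult substitute_const substitute_variable)

lemma substitute_congruent_modulo:
  fixes h :: "'x::finite \<Rightarrow> ('x, 'k::field) mpoly"
  assumes "\<And>x. variable x - h x \<in> ideal L"
  shows "p - substitute h p \<in> ideal L"
proof (induction p rule: mpoly_induct)
  case (add p q)
  from poly_ideal.span_add[OF this] show ?case by (simp add: substitute_add algebra_simps)
next
  case (mult p q)
  have "p * q - substitute h (p * q) = q * (p - substitute h p) + substitute h p * (q - substitute h q)"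
    by (simp add: substitute_mult algebra_simps)
  then show ?case using mult by (simp add: poly_ideal.span_add poly_ideal.span_scale)
qed (simp_all add: assms substitute_const substitute_variable poly_ideal.span_zero)

lemma ideal_insert_mono: "p \<in> ideal L \<Longrightarrow> p \<in> ideal (insert l L)"
  using poly_ideal.span_mono[of L "insert l L"] by blast

text \<open>
  An endomorphism of the polynomial ring that presents the quotient by \<open>(L)\<close> as a subring: its
  kernel is exactly \<open>(L)\<close>.
\<close>

definition linear_retraction ::
  "('x::finite, 'k::field) mpoly set \<Rightarrow> (('x, 'k) mpoly \<Rightarrow> ('x, 'k) mpoly) \<Rightarrow> bool" where
  "linear_retraction L \<phi> \<longleftrightarrow>
    (\<forall>p q. \<phi> (p + q) = \<phi> p + \<phi> q) \<and> (\<forall>p q. \<phi> (p * q) = \<phi> p * \<phi> q) \<and>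
    (\<forall>l\<in>linear_forms. \<phi> l \<in> linear_forms) \<and> (\<forall>l\<in>L. \<phi> l = 0) \<and> (\<forall>p. p - \<phi> p \<in> ideal L)"

text \<open>
  Gaussian elimination. Given a retraction \<open>\<phi>\<close> for \<open>L\<close> and a new form \<open>l\<close> with \<open>\<phi> l \<noteq> 0\<close>, solve
  \<open>\<phi> l = 0\<close> for a variable \<open>y\<close> that occurs in \<open>\<phi> l\<close>, and follow \<open>\<phi>\<close> by the substitution of the
  solution for \<open>y\<close>.
\<close>

lemma linear_ideal_retraction:
  fixes L :: "('x::finite, 'k::field) mpoly set"
  assumes "finite L" "L \<subseteq> linear_forms"
  shows "\<exists>\<phi>. linear_retraction L \<phi>"
  using assms
proof (induction L rule: finite_induct)
  case empty
  then show ?case by (intro exI[of _ "\<lambda>p. p"]) (simp add: linear_retraction_def poly_ideal.span_zero)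
next
  case (insert l L)
  then obtain \<phi> where "linear_retraction L \<phi>" by auto
  then have add: "\<And>p q. \<phi> (p + q) = \<phi> p + \<phi> q" and mult: "\<And>p q. \<phi> (p * q) = \<phi> p * \<phi> q"
    and lin: "\<And>p. p \<in> linear_forms \<Longrightarrow> \<phi> p \<in> linear_forms"
    and vanish: "\<And>p. p \<in> L \<Longrightarrow> \<phi> p = 0" and mod: "\<And>p. p - \<phi> p \<in> ideal L"
    unfolding linear_retraction_def by blast+
  show ?case
  proof (cases "\<phi> l = 0")
    case True
    then show ?thesis
      using add mult lin vanish mod ideal_insert_mono unfolding linear_retraction_def
      by (intro exI[of _ \<phi>]) blast
  next
    case False
    have \<phi>l: "\<phi> l \<in> linear_forms" using insert.prems lin by blast
    define a where "a x = Poly_Mapping.lookup (\<phi> l) (Poly_Mapping.single x 1)" for x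
    have exp: "\<phi> l = (\<Sum>x\<in>UNIV. const (a x) * variable x)"
      using linear_form_expansion[OF \<phi>l] by (simp add: a_def)
    obtain y where y: "a y \<noteq> 0" using False exp by force
    define h where "h x = (if x = y then variable y - const (inverse (a y)) * \<phi> l else variable x)" for x
    let ?\<psi> = "substitute h"
    have zero: "\<phi> 0 = 0" using add[of 0 0] by simp
    have "const c * \<phi> l \<in> linear_forms" for c
      using homogeneous_mult[OF homogeneous_const \<phi>l] by simp
    then have "variable y - const c * \<phi> l \<in> linear_forms" for c
      using homogeneous_add[OF variable_linear[of y] homogeneous_uminus[of "const c * \<phi> l" 1]] by simp
    then have h_lin: "h x \<in> linear_forms" for x by (simp add: h_def)
    have "const c * h x \<in> linear_forms" for c x
      using homogeneous_mult[OF homogeneous_const h_lin] by simp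
    then have \<psi>_lin: "?\<psi> p \<in> linear_forms" if "p \<in> linear_forms" for p
      unfolding substitute_linear_form[OF that] by (intro homogeneous_sum)
    have "?\<psi> (\<phi> l) = (\<Sum>x\<in>UNIV. const (a x) * h x)"
      by (simp add: substitute_linear_form[OF \<phi>l] a_def)
    also have "\<dots> = (\<Sum>x\<in>UNIV. const (a x) * variable x -
        (if x = y then const (a y) * const (inverse (a y)) * \<phi> l else 0))"
      by (rule sum.cong) (auto simp only: h_def right_diff_distrib mult.assoc diff_0_right if_True if_False split: if_split)
    also have "\<dots> = \<phi> l - const (a y) * const (inverse (a y)) * \<phi> l"
      by (simp add: sum_subtractf flip: exp)
    also have "\<dots> = 0" using y by (simp add: mult_single)
    finally have \<psi>\<phi>l: "?\<psi> (\<phi> l) = 0" .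
    have \<phi>l_in: "\<phi> l \<in> ideal (insert l L)"
    proof -
      have "l - (l - \<phi> l) \<in> ideal (insert l L)"
        by (intro poly_ideal.span_diff ideal_insert_mono[OF mod]) (simp add: poly_ideal.span_base)
      then show ?thesis by simp
    qed
    have \<psi>_mod: "p - ?\<psi> p \<in> ideal (insert l L)" for p
      by (rule substitute_congruent_modulo)
        (auto simp: h_def intro: poly_ideal.span_scale[OF \<phi>l_in] poly_ideal.span_zero)
    have "p - ?\<psi> (\<phi> p) \<in> ideal (insert l L)" for p
      using poly_ideal.span_add[OF ideal_insert_mono[OF mod[of p]] \<psi>_mod[of "\<phi> p"]] by simp
    then show ?thesis
      using add mult lin \<psi>_lin vanish \<psi>\<phi>l unfolding linear_retraction_def
      by (intro exI[of _ "\<lambda>p. ?\<psi> (\<phi> p)"]) (auto simp: substitute_add substitute_mult substitute_zero)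
  qed
qed

text \<open>
  An ideal generated by linear forms behaves like a prime ideal towards linear forms: a retraction
  turns membership in \<open>(L)\<close> into vanishing, and takes \<open>l\<close> to a nonzero linear form, which can be
  cancelled.
\<close>

lemma linear_form_nonzerodivisor_modulo:
  fixes l p :: "('x::finite, 'k::field) mpoly"
  assumes L: "L \<subseteq> linear_forms" and l: "l \<in> linear_forms" "l \<notin> ideal L" and pl: "p * l \<in> ideal L"
  shows "p \<in> ideal L"
proof -
  obtain B where B: "B \<subseteq> L" "finite B" "ideal B = ideal L"
    using linear_ideal_finitely_generated[OF L] by blast
  then obtain \<phi> where "linear_retraction B \<phi>"
    using linear_ideal_retraction[of B] L by blast
  then have add: "\<And>p q. \<phi> (p + q) = \<phi> p + \<phi> q" and mult: "\<And>p q. \<phi> (p * q) = \<phi> p * \<phi> q"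
    and lin: "\<And>p. p \<in> linear_forms \<Longrightarrow> \<phi> p \<in> linear_forms"
    and vanish: "\<And>p. p \<in> B \<Longrightarrow> \<phi> p = 0" and mod: "\<And>p. p - \<phi> p \<in> ideal L"
    unfolding linear_retraction_def B(3) by blast+
  have zero: "\<phi> 0 = 0" using add[of 0 0] by simp
  have kernel: "\<phi> q = 0" if "q \<in> ideal B" for q
    using that by (induction rule: poly_ideal.span_induct_alt) (simp_all add: zero add mult vanish)
  have "\<phi> l \<noteq> 0" using mod[of l] l(2) by auto
  moreover have "\<phi> l * \<phi> p = 0"
    using kernel[of "p * l"] pl B(3) by (simp add: mult mult.commute)
  ultimately have "\<phi> p = 0" using linear_form_mult_eq_zero lin[OF l(1)] by blast
  then show ?thesis using mod[of p] by simp
qed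

section \<open>Syzygies of modules with linear quotients\<close>

text \<open>
  Linear quotients for a list of generators. The colon ideal of a generator depends only on the
  preceding ones, so that a list can be extended without looking back; unlike
  \<open>has_linear_quotients\<close>, a colon ideal may not be the whole ring, since an ideal generated by linear
  forms is proper.
\<close>

inductive linear_quotient_list ::
  "(('x::finite, 'k::field) mpoly \<Rightarrow> 'm::ab_group_add \<Rightarrow> 'm) \<Rightarrow> 'm list \<Rightarrow> bool"
  for scale where
  Nil: "linear_quotient_list scale []"
| snoc: "linear_quotient_list scale gs \<Longrightarrow>
    generated_by_linear_forms {p. scale p g \<in> module.span scale (set gs)} \<Longrightarrow>
    linear_quotient_list scale (gs @ [g])"

definition vscale :: "('x, 'k::field) mpoly \<Rightarrow> (nat \<Rightarrow> ('x, 'k) mpoly) \<Rightarrow> nat \<Rightarrow> ('x, 'k) mpoly" where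
  "vscale p v = (\<lambda>j. p * v j)"

lemma vscale_apply: "vscale p v j = p * v j"
  by (simp add: vscale_def)

interpretation vec: module vscale
  by unfold_locales
    (rule ext, simp only: vscale_apply plus_fun_apply distrib_left distrib_right mult.assoc mult_1_left)+

definition syzygies where
  "syzygies scale gs = {v \<in> free_module (length gs). free_eval scale (length gs) ((!) gs) v = 0}"

lemma free_eval_snoc:
  "free_eval scale (length (gs @ [g])) ((!) (gs @ [g])) v
    = free_eval scale (length gs) ((!) gs) v + scale (v (length gs)) g"
  by (simp add: free_eval_def nth_append)

locale polynomial_module = module scale
  for scale :: "('x::finite, 'k::field) mpoly \<Rightarrow> 'm::ab_group_add \<Rightarrow> 'm"
begin

lemma free_eval_in_span: "free_eval scale (length gs) ((!) gs) v \<in> span (set gs)"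
  unfolding free_eval_def by (rule span_sum, rule span_scale, rule span_base) simp

lemma span_image_finite:
  assumes "finite A" "v \<in> span (h ` A)"
  shows "\<exists>q. v = (\<Sum>i\<in>A. scale (q i) (h i))"
  using assms
proof (induction A arbitrary: v rule: finite_induct)
  case (insert i A)
  then obtain k where "v - scale k (h i) \<in> span (h ` A)"
    by (auto simp: span_insert)
  with insert.IH obtain q where "v - scale k (h i) = (\<Sum>i\<in>A. scale (q i) (h i))" by blast
  then have "v = scale k (h i) + (\<Sum>i\<in>A. scale (q i) (h i))" by (simp add: algebra_simps)
  also have "(\<Sum>i\<in>A. scale (q i) (h i)) = (\<Sum>l\<in>A. scale ((q(i := k)) l) (h l))"
    using insert.hyps by (intro sum.cong) auto
  finally have "v = (\<Sum>l\<in>insert i A. scale ((q(i := k)) l) (h l))"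
    using insert.hyps by simp
  then show ?case by blast
qed simp

lemma span_eq_free_eval_image:
  "span (set gs) = free_eval scale (length gs) ((!) gs) ` free_module (length gs)"
proof (intro equalityI subsetI)
  fix u assume "u \<in> span (set gs)"
  moreover have "set gs = (!) gs ` {..<length gs}" by (auto simp: in_set_conv_nth)
  ultimately obtain q where q: "u = (\<Sum>i<length gs. scale (q i) (gs ! i))"
    using span_image_finite[of "{..<length gs}" u "(!) gs"] by auto
  let ?v = "\<lambda>i. if i < length gs then q i else 0"
  have "u = free_eval scale (length gs) ((!) gs) ?v" by (simp add: q free_eval_def)
  moreover have "?v \<in> free_module (length gs)" by (simp add: free_module_def)
  ultimately show "u \<in> free_eval scale (length gs) ((!) gs) ` free_module (length gs)" by blast
next
  fix u assume "u \<in> free_eval scale (length gs) ((!) gs) ` free_module (length gs)"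
  then show "u \<in> span (set gs)" using free_eval_in_span by blast
qed

lemma free_eval_diff:
  "free_eval scale n g (v - w) = free_eval scale n g v - free_eval scale n g w"
  by (simp add: free_eval_def scale_left_diff_distrib sum_subtractf)

lemma free_eval_vscale: "free_eval scale n g (vscale p v) = scale p (free_eval scale n g v)"
  by (simp add: free_eval_def vscale_def scale_sum_right)

lemma syzygies_vscale:
  assumes "s \<in> syzygies scale gs" shows "vscale p s \<in> syzygies scale gs"
proof -
  have "vscale p s \<in> free_module (length gs)"
    using assms by (simp add: syzygies_def free_module_def vscale_def)
  then show ?thesis using assms by (simp add: syzygies_def free_eval_vscale)
qed

lemma syzygies_diff:
  assumes "s \<in> syzygies scale gs"
  shows "v - s \<in> syzygies scale gs \<longleftrightarrow> v \<in> syzygies scale gs"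
proof -
  have "s \<in> free_module (length gs)" "free_eval scale (length gs) ((!) gs) s = 0"
    using assms by (simp_all add: syzygies_def)
  moreover from this(1) have "v - s \<in> free_module (length gs) \<longleftrightarrow> v \<in> free_module (length gs)"
    by (simp add: free_module_def)
  ultimately show ?thesis by (simp add: syzygies_def free_eval_diff)
qed

lemma syzygies_snoc_zero:
  "v \<in> syzygies scale gs \<longleftrightarrow> v \<in> syzygies scale (gs @ [g]) \<and> v (length gs) = 0"
proof -
  have "v \<in> free_module (length gs) \<longleftrightarrow> v \<in> free_module (Suc (length gs)) \<and> v (length gs) = 0"
    unfolding free_module_def mem_Collect_eq by (metis Suc_leD le_antisym not_less_eq_eq order_refl)
  then show ?thesis
    unfolding syzygies_def free_eval_snoc by (auto simp: free_eval_def)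
qed

text \<open>
  The relations among the members of the list form a graded submodule when all generators are
  given the same degree.
\<close>

definition graded_relations :: "'m list \<Rightarrow> bool" where
  "graded_relations gs \<longleftrightarrow> (\<forall>v d. free_eval scale (length gs) ((!) gs) v = 0 \<longrightarrow>
     free_eval scale (length gs) ((!) gs) (\<lambda>l. hcomp d (v l)) = 0)"

text \<open>
  The class of modules with linear quotients whose generators have one common degree is closed
  under syzygies. The relations among \<open>gs\<close> and a further generator \<open>g\<close>, modulo those among \<open>gs\<close>,
  are identified with the colon ideal \<open>I\<close> of \<open>g\<close> by their last coordinate. A generating linear form
  \<open>l\<close> of \<open>I\<close> lifts to a relation \<open>s\<close> with last coordinate \<open>l\<close> and, after passing to components of
  degree one, with linear entries. Generators for the relations among \<open>gs\<close> can thus be extended by one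
  such lift for each form \<open>l\<close> outside the ideal \<open>(C)\<close> of the forms treated before. A multiple \<open>p s\<close>
  is generated by the earlier lifts iff \<open>p l \<in> (C)\<close>, that is, iff \<open>p \<in> (C)\<close>: the new colon ideal is
  generated by linear forms again.
\<close>

lemma syzygies_generated:
  assumes "linear_quotient_list scale gs" "graded_relations gs"
  shows "\<exists>Y. linear_quotient_list vscale Y \<and> (\<forall>y\<in>set Y. \<forall>j. y j \<in> linear_forms) \<and>
    vec.span (set Y) = syzygies scale gs"
  using assms
proof (induction rule: linear_quotient_list.induct)
  case Nil
  have "syzygies scale [] = {0}"
    by (auto simp: syzygies_def free_module_def free_eval_def)
  then show ?case
    by (intro exI[of _ "[]"]) (simp add: linear_quotient_list.Nil)
next
  case (snoc gs g)
  let ?n = "length gs"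
  let ?I = "{p. scale p g \<in> span (set gs)}"
  have "graded_relations gs"
    unfolding graded_relations_def
  proof (intro allI impI)
    fix v d assume v: "free_eval scale ?n ((!) gs) v = 0"
    \<comment> \<open>A relation among \<open>gs\<close> is a relation among \<open>gs @ [g]\<close> with last coordinate \<open>0\<close>.\<close>
    let ?w = "v(?n := 0)"
    have eq: "free_eval scale (length (gs @ [g])) ((!) (gs @ [g])) (\<lambda>l. hc (?w l))
      = free_eval scale ?n ((!) gs) (\<lambda>l. hc (v l))" if "hc 0 = 0" for hc
      unfolding free_eval_snoc using that by (simp add: free_eval_def)
    show "free_eval scale ?n ((!) gs) (\<lambda>l. hcomp d (v l)) = 0"
      using snoc.prems v eq[of "\<lambda>p. p"] eq[of "hcomp d"] unfolding graded_relations_def by fastforce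
  qed
  then obtain Y0 where Y0: "linear_quotient_list vscale Y0" "\<forall>y\<in>set Y0. \<forall>j. y j \<in> linear_forms"
      "vec.span (set Y0) = syzygies scale gs"
    using snoc.IH by blast
  obtain L where "L \<subseteq> linear_forms" "?I = ideal L"
    using snoc.hyps(2) unfolding generated_by_linear_forms_def by blast
  then obtain B where B: "B \<subseteq> linear_forms" "finite B" "?I = ideal B"
    using linear_ideal_finitely_generated[of L] by (metis (no_types) subset_trans)
  have "\<exists>Y. linear_quotient_list vscale Y \<and> (\<forall>y\<in>set Y. \<forall>j. y j \<in> linear_forms) \<and>
    vec.span (set Y) = {v \<in> syzygies scale (gs @ [g]). v ?n \<in> ideal C}"
    if "C \<subseteq> B" for C
    using finite_subset[OF that B(2)] that
  proof (induction C rule: finite_induct)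
    case empty
    have "syzygies scale gs = {v \<in> syzygies scale (gs @ [g]). v ?n \<in> ideal {}}"
      using syzygies_snoc_zero[of _ gs g] by auto
    then show ?case using Y0 by auto
  next
    case (insert l C)
    then obtain Y where Y: "linear_quotient_list vscale Y" "\<forall>y\<in>set Y. \<forall>j. y j \<in> linear_forms"
      "vec.span (set Y) = {v \<in> syzygies scale (gs @ [g]). v ?n \<in> ideal C}" by auto
    show ?case
    proof (cases "l \<in> ideal C")
      case True
      then have "ideal (insert l C) = ideal C"
        by (intro poly_ideal.span_eq[THEN iffD2]) (auto intro: poly_ideal.span_base)
      then show ?thesis using Y by auto
    next
      case False
      have l: "l \<in> linear_forms" using insert.prems B(1) by blast
      have C: "C \<subseteq> linear_forms" using insert.prems B(1) by blast
      have "l \<in> ?I" using insert.prems B(3) by (auto intro: poly_ideal.span_base)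
      then obtain c where c: "scale l g = free_eval scale ?n ((!) gs) c"
        unfolding span_eq_free_eval_image by blast
      \<comment> \<open>\<open>w\<close> has the required last coordinate, and its component of degree one has linear entries too.\<close>
      define w where "w i = (if i < ?n then - c i else if i = ?n then l else 0)" for i
      have "free_eval scale ?n ((!) gs) w = - scale l g"
        unfolding c by (simp add: free_eval_def w_def sum_negf)
      then have w: "free_eval scale (length (gs @ [g])) ((!) (gs @ [g])) w = 0"
        unfolding free_eval_snoc by (simp add: w_def)
      define s where "s = (\<lambda>i. hcomp 1 (w i))"
      have "free_eval scale (length (gs @ [g])) ((!) (gs @ [g])) s = 0"
        using snoc.prems w unfolding graded_relations_def s_def by blast
      moreover have "s \<in> free_module (length (gs @ [g]))"
        by (simp add: s_def free_module_def w_def)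
      ultimately have s: "s \<in> syzygies scale (gs @ [g])"
        by (simp add: syzygies_def)
      have s_lin: "\<forall>j. s j \<in> linear_forms" by (simp add: s_def)
      have s_n: "s ?n = l" using l by (simp add: s_def w_def hcomp_of_homogeneous)
      have "vscale p s \<in> vec.span (set Y) \<longleftrightarrow> p * l \<in> ideal C" for p
        using syzygies_vscale[OF s, of p] by (simp add: Y(3) vscale_apply s_n)
      also have "p * l \<in> ideal C \<longleftrightarrow> p \<in> ideal C" for p
        using linear_form_nonzerodivisor_modulo[OF C l False, of p] poly_ideal.span_scale[of p C l]
        by (auto simp: mult.commute)
      finally have colon: "generated_by_linear_forms {p. vscale p s \<in> vec.span (set Y)}"
        using C unfolding generated_by_linear_forms_def by auto
      have "vec.span (set (Y @ [s])) = {v. \<exists>k. v - vscale k s \<in> vec.span (set Y)}"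
        by (simp add: vec.span_insert)
      also have "\<dots> = {v \<in> syzygies scale (gs @ [g]). v ?n \<in> ideal (insert l C)}"
        unfolding Y(3) poly_ideal.span_insert using syzygies_diff[OF syzygies_vscale[OF s]]
        by (auto simp: vscale_apply s_n)
      finally show ?thesis
        using linear_quotient_list.snoc[OF Y(1) colon] Y(2) s_lin
        by (intro exI[of _ "Y @ [s]"]) auto
    qed
  qed
  from this[of B] obtain Y where Y: "linear_quotient_list vscale Y" "\<forall>y\<in>set Y. \<forall>j. y j \<in> linear_forms"
    "vec.span (set Y) = {v \<in> syzygies scale (gs @ [g]). v ?n \<in> ideal B}" by auto
  moreover have "v ?n \<in> ideal B" if "v \<in> syzygies scale (gs @ [g])" for v
  proof -
    have "scale (v ?n) g = - free_eval scale ?n ((!) gs) v"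
      using that unfolding syzygies_def free_eval_snoc by (simp add: eq_neg_iff_add_eq_0 add.commute)
    then have "v ?n \<in> ?I" using free_eval_in_span span_neg by simp
    then show ?thesis using B(3) by simp
  qed
  ultimately show ?case by (intro exI[of _ Y]) auto
qed

end

interpretation free: polynomial_module vscale ..

lemma free_eval_vscale_apply: "free_eval vscale n X v j = (\<Sum>l<n. v l * X l j)"
proof -
  have "(\<Sum>l\<in>A. vscale (v l) (X l)) j = (\<Sum>l\<in>A. v l * X l j)" for A
    by (induction A rule: infinite_finite_induct) (simp_all add: vscale_apply)
  then show ?thesis by (simp add: free_eval_def)
qed

lemma graded_relations_linear_entries:
  assumes "\<forall>y\<in>set Y. \<forall>j. y j \<in> linear_forms"
  shows "free.graded_relations Y"
  unfolding free.graded_relations_def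
proof (intro allI impI)
  fix v d assume v: "free_eval vscale (length Y) ((!) Y) v = 0"
  note eval = free_eval_vscale_apply[of "length Y" "(!) Y"]
  show "free_eval vscale (length Y) ((!) Y) (\<lambda>l. hcomp d (v l)) = 0"
  proof
    fix j
    have "free_eval vscale (length Y) ((!) Y) (\<lambda>l. hcomp d (v l)) j
        = (\<Sum>l<length Y. hcomp (d + 1) (v l * (Y ! l) j))"
      unfolding eval using assms by (intro sum.cong) (auto simp: hcomp_mult[of _ 1])
    also have "\<dots> = hcomp (d + 1) (free_eval vscale (length Y) ((!) Y) v j)"
      by (simp add: eval hcomp_sum)
    finally show "free_eval vscale (length Y) ((!) Y) (\<lambda>l. hcomp d (v l)) j = 0 j"
      by (simp add: v)
  qed
qed

section \<open>The linear resolution\<close>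

lemma free_map_eq_free_eval:
  assumes "\<And>l. l < n \<Longrightarrow> X ! l \<in> free_module c"
  shows "free_map n c (\<lambda>l. X ! l) v = free_eval vscale n ((!) X) v"
proof
  fix j
  show "free_map n c (\<lambda>l. X ! l) v j = free_eval vscale n ((!) X) v j"
    using assms by (auto simp: free_map_def free_eval_vscale_apply free_module_def)
qed

context polynomial_module begin

text \<open>
  Iterating \<open>syzygies_generated\<close> yields a resolution whose matrices consist of linear forms. Such
  a resolution is minimal, and if the generators have degree \<open>k\<close>, the basis vectors in homological
  degree \<open>i\<close> have degree \<open>k + i\<close>.
\<close>

lemma linear_quotient_list_resolution:
  assumes lq: "linear_quotient_list scale gs" and rel: "graded_relations gs"
    and comp: "set gs \<subseteq> component k"
  shows "has_linear_resolution scale component (span (set gs))"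
proof -
  define good where "good Y \<longleftrightarrow> linear_quotient_list vscale Y \<and> (\<forall>y\<in>set Y. \<forall>j. y j \<in> linear_forms)"
    for Y :: "(nat \<Rightarrow> ('x, 'k) mpoly) list"
  have start: "\<exists>Y. good Y \<and> vec.span (set Y) = syzygies scale gs"
    using syzygies_generated[OF lq rel] by (auto simp: good_def)
  have step: "\<exists>Z. good Z \<and> vec.span (set Z) = syzygies vscale Y" if "good Y" for Y
    using free.syzygies_generated[of Y] graded_relations_linear_entries[of Y] that
    by (auto simp: good_def)
  have "\<exists>X. \<forall>n. (good (X n) \<and> (n = 0 \<longrightarrow> vec.span (set (X n)) = syzygies scale gs)) \<and>
    vec.span (set (X (Suc n))) = syzygies vscale (X n)"
    by (rule dependent_nat_choice) (use start step in auto)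
  then obtain X where good: "\<And>i. good (X i)" and X0: "vec.span (set (X 0)) = syzygies scale gs"
    and XSuc: "\<And>i. vec.span (set (X (Suc i))) = syzygies vscale (X i)" by blast
  \<comment> \<open>\<open>X i\<close> lists the columns of the differential \<open>F\<^bsub>i+1\<^esub> \<rightarrow> F\<^sub>i\<close>.\<close>
  define b where "b i = (case i of 0 \<Rightarrow> length gs | Suc i \<Rightarrow> length (X i))" for i
  have b0: "b 0 = length gs" and bSuc: "b (Suc i) = length (X i)" for i
    by (simp_all add: b_def)
  let ?a = "\<lambda>i (j::nat). k + int i"
  let ?D = "\<lambda>i l. X i ! l"
  have entries: "X i ! l \<in> free_module (b i)" if "l < b (Suc i)" for i l
  proof -
    have "X i ! l \<in> vec.span (set (X i))" using that by (simp add: bSuc vec.span_base)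
    then show ?thesis
      by (cases i) (auto simp: X0 XSuc b0 bSuc syzygies_def)
  qed
  have map: "free_map (b (Suc i)) (b i) (?D i) v = free_eval vscale (length (X i)) ((!) (X i)) v" for i v
    using free_map_eq_free_eval[of "b (Suc i)" "X i" "b i" v] entries by (simp add: bSuc)
  have image: "free_map (b (Suc i)) (b i) (?D i) ` free_module (b (Suc i)) = vec.span (set (X i))" for i
    unfolding map unfolding bSuc free.span_eq_free_eval_image ..
  have linear: "(X i ! l) j \<in> linear_forms" if "l < b (Suc i)" for i l j
    using good[of i] that by (simp add: good_def bSuc)
  have "graded_free_resolution scale component (span (set gs)) b ?a ((!) gs) ?D"
    unfolding graded_free_resolution_def
  proof (intro conjI allI impI)
    show "gs ! l \<in> component (k + int 0)" if "l < b 0" for l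
      using comp that by (auto simp: b0)
    show "(X i ! l) j \<in> homogeneous_polys (k + int (Suc i) - (k + int i))" if "l < b (Suc i)" "j < b i" for i l j
      using linear[OF that(1)] by simp
    show "free_eval scale (b 0) ((!) gs) ` free_module (b 0) = span (set gs)"
      unfolding b0 span_eq_free_eval_image ..
    show "free_map (b 1) (b 0) (?D 0) ` free_module (b 1)
        = {v \<in> free_module (b 0). free_eval scale (b 0) ((!) gs) v = 0}"
      using image[of 0] by (simp add: X0 syzygies_def b0)
    show "free_map (b (Suc (Suc i))) (b (Suc i)) (?D (Suc i)) ` free_module (b (Suc (Suc i)))
        = {v \<in> free_module (b (Suc i)). free_map (b (Suc i)) (b i) (?D i) v = (\<lambda>_. 0)}" for i
      unfolding image map unfolding XSuc syzygies_def bSuc zero_fun_def ..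
  qed
  then have "minimal_graded_free_resolution scale component (span (set gs)) b ?a ((!) gs) ?D"
    unfolding minimal_graded_free_resolution_def
    using linear linear_form_in_graded_maximal_ideal by blast
  then show ?thesis
    unfolding has_linear_resolution_def by blast
qed

end

section \<open>Truncation of a cyclic quotient\<close>

abbreviation maximal_ideal_power :: "nat \<Rightarrow> ('x::finite, 'k::field) mpoly set" where
  "maximal_ideal_power e \<equiv> ideal (homogeneous_polys (int e))"

lemma homogeneous_negative: "d < 0 \<Longrightarrow> p \<in> homogeneous_polys d \<Longrightarrow> p = 0"
  by (rule poly_mapping_eqI) (force simp: homogeneous_polys_def in_keys_iff)

lemma hcomp_maximal_ideal_power:
  assumes "p \<in> maximal_ideal_power e" "d < int e" shows "hcomp d p = 0"
  using assms(1)
proof (induction rule: poly_ideal.span_induct_alt)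
  case (step c l y)
  have "hcomp (d - int e) c = 0"
    using assms(2) by (intro homogeneous_negative[OF _ hcomp_homogeneous]) simp
  then show ?case using step hcomp_mult[of l "int e" d c] by (simp add: hcomp_add)
qed simp

lemma monomial_divisor_of_degree:
  "e \<le> monomial_degree t \<Longrightarrow> \<exists>u w. t = u + w \<and> monomial_degree u = e"
proof (induction e)
  case 0
  show ?case by (intro exI[of _ 0] exI[of _ t]) (simp add: monomial_degree_def)
next
  case (Suc e)
  then obtain u w where uw: "t = u + w" "monomial_degree u = e" by auto
  then have "monomial_degree w \<noteq> 0" using Suc.prems by (simp add: monomial_degree_add)
  then obtain x where x: "Poly_Mapping.lookup w x \<noteq> 0"
    unfolding monomial_degree_def by (metis sum.neutral)
  have "w = Poly_Mapping.single x 1 + (w - Poly_Mapping.single x 1)"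
    using x by (intro poly_mapping_eqI) (auto simp: lookup_add lookup_minus lookup_single when_def)
  then have "t = (u + Poly_Mapping.single x 1) + (w - Poly_Mapping.single x 1)"
    using uw(1) by (simp add: add.assoc)
  moreover have "monomial_degree (u + Poly_Mapping.single x 1) = Suc e"
    using uw(2) by (simp add: monomial_degree_add)
  ultimately show ?case by blast
qed

lemma homogeneous_in_maximal_ideal_power:
  assumes p: "p \<in> homogeneous_polys d" and d: "int e \<le> d"
  shows "p \<in> maximal_ideal_power e"
proof -
  have "Poly_Mapping.single t (Poly_Mapping.lookup p t) \<in> maximal_ideal_power e"
    if "t \<in> Poly_Mapping.keys p" for t
  proof -
    have "e \<le> monomial_degree t" using that p d by (auto simp: homogeneous_polys_def)
    then obtain u w where uw: "t = u + w" "monomial_degree u = e"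
      using monomial_divisor_of_degree by blast
    have "Poly_Mapping.single u 1 \<in> homogeneous_polys (int e)"
      by (simp add: homogeneous_polys_def uw(2))
    from poly_ideal.span_scale[OF poly_ideal.span_base[OF this], of "Poly_Mapping.single w (Poly_Mapping.lookup p t)"]
    show ?thesis by (simp add: mult_single uw(1) add.commute)
  qed
  then show ?thesis by (subst sum_of_terms) (rule poly_ideal.span_sum)
qed

lemma maximal_ideal_power_mult_variable:
  assumes "q \<in> maximal_ideal_power e" shows "q * variable x \<in> maximal_ideal_power (Suc e)"
  using assms
proof (induction rule: poly_ideal.span_induct_alt)
  case base
  show ?case by (simp add: poly_ideal.span_zero)
next
  case (step c l y)
  have "l * variable x \<in> homogeneous_polys (int (Suc e))"
    using homogeneous_mult[OF step(1) variable_linear] by (simp add: add.commute)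
  from poly_ideal.span_add[OF poly_ideal.span_scale[OF poly_ideal.span_base[OF this], of c] step(2)]
  show ?case by (simp only: distrib_right mult.assoc)
qed

lemma maximal_ideal_power_zero: "maximal_ideal_power 0 = UNIV"
proof -
  have "p * 1 \<in> maximal_ideal_power 0" for p
    using homogeneous_const[of 1] by (intro poly_ideal.span_scale poly_ideal.span_base) simp
  then show ?thesis by auto
qed

context polynomial_module begin

lemma span_image_scale: "span ((\<lambda>p. scale p f) ` P) = (\<lambda>p. scale p f) ` ideal P"
proof -
  interpret h: module_hom "(*)" scale "\<lambda>p. scale p f"
    by unfold_locales (simp_all only: scale_left_distrib scale_scale)
  show ?thesis by (rule h.span_image)
qed

text \<open>
  Let \<open>N\<close> be the span of \<open>gs\<close>. The hypothesis says that \<open>(N + \<mm>\<^sup>e f) / N\<close> is a copy of the truncation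
  \<open>(\<mm>\<^sup>e + (L)) / (L)\<close> of the polynomial ring \<open>S / (L)\<close>, and the lemma extends \<open>gs\<close> to generators of
  \<open>N + \<mm>\<^sup>e f\<close>, adding only elements of \<open>S\<^sub>e f\<close>. For \<open>e = 0\<close> the single element \<open>f\<close> does. Otherwise
  choose a variable \<open>z\<close> outside \<open>(L)\<close>. As \<open>z\<close> is a nonzerodivisor modulo \<open>(L)\<close>, the induction on \<open>e\<close>
  applies to \<open>z f\<close> with the same \<open>L\<close> and reaches \<open>N + \<mm>\<^bsup>e-1\<^esup> z f\<close>; relative to that submodule, \<open>f\<close>
  satisfies the hypothesis with \<open>(L, z)\<close> in place of \<open>(L)\<close>, which contains more variables. If \<open>(L)\<close>
  contains all variables, then \<open>\<mm>\<^sup>e \<subseteq> (L)\<close> and nothing has to be added.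
\<close>

lemma truncated_cyclic_extension:
  assumes "linear_quotient_list scale gs" "L \<subseteq> linear_forms"
    and "\<forall>p\<in>maximal_ideal_power e. scale p f \<in> span (set gs) \<longleftrightarrow> p \<in> ideal L"
  shows "\<exists>gs'. linear_quotient_list scale gs' \<and>
    set gs' \<subseteq> set gs \<union> (\<lambda>p. scale p f) ` homogeneous_polys (int e) \<and>
    span (set gs') = span (set gs \<union> (\<lambda>p. scale p f) ` homogeneous_polys (int e))"
  using assms
proof (induction e arbitrary: gs L f)
  case 0
  let ?S = "(\<lambda>p. scale p f) ` homogeneous_polys (int 0)"
  have "{p. scale p f \<in> span (set gs)} = ideal L"
    using 0(3) unfolding maximal_ideal_power_zero by blast
  then have lq: "linear_quotient_list scale (gs @ [f])"
    using 0(1,2) linear_quotient_list.snoc unfolding generated_by_linear_forms_def by blast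
  have f: "f \<in> ?S" using homogeneous_const[of 1] by (intro image_eqI[of _ _ 1]) simp_all
  have "span (set (gs @ [f])) = span (set gs \<union> ?S)"
    using f by (intro span_eq[THEN iffD2]) (auto intro: span_base span_scale)
  with lq f show ?case by (intro exI[of _ "gs @ [f]"]) auto
next
  case (Suc e)
  note outer = Suc.IH
  let ?S = "(\<lambda>p. scale p f) ` homogeneous_polys (int (Suc e))"
  have "\<exists>gs'. linear_quotient_list scale gs' \<and> set gs' \<subseteq> set gs \<union> ?S \<and> span (set gs') = span (set gs \<union> ?S)"
    using Suc.prems
  proof (induction "card {x. variable x \<notin> ideal L}" arbitrary: gs L rule: less_induct)
    case less
    note lq = less.prems(1) and L = less.prems(2) and colon = less.prems(3)
    show ?case
    proof (cases "\<exists>x. variable x \<notin> ideal L")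
      case False
      have "linear_forms \<subseteq> ideal L"
      proof
        fix l :: "('x, 'k) mpoly" assume "l \<in> linear_forms"
        then have "l \<in> ideal (range variable)"
          using linear_form_in_graded_maximal_ideal unfolding graded_maximal_ideal_def by blast
        also have "\<dots> \<subseteq> ideal L"
          using False by (intro poly_ideal.span_minimal) auto
        finally show "l \<in> ideal L" .
      qed
      then have power_1: "maximal_ideal_power 1 \<subseteq> ideal L"
        by (intro poly_ideal.span_minimal) auto
      have "scale p f \<in> span (set gs)" if p: "p \<in> homogeneous_polys (int (Suc e))" for p
      proof -
        have "p \<in> ideal L"
          using homogeneous_in_maximal_ideal_power[OF p, of 1] power_1 by auto
        then show ?thesis using colon p by (auto intro: poly_ideal.span_base)
      qed
      then have "span (set gs) = span (set gs \<union> ?S)"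
        by (intro span_eq[THEN iffD2]) (auto intro: span_base)
      with lq show ?thesis by (intro exI[of _ gs]) auto
    next
      case True
      then obtain x where x: "variable x \<notin> ideal L" by blast
      let ?z = "variable x"
      let ?T = "(\<lambda>p. scale p (scale ?z f)) ` homogeneous_polys (int e)"
      have TS: "?T \<subseteq> ?S"
      proof (intro image_subsetI)
        fix p :: "('x, 'k) mpoly" assume "p \<in> homogeneous_polys (int e)"
        from homogeneous_mult[OF this variable_linear] show "scale p (scale ?z f) \<in> ?S"
          by (intro image_eqI[of _ _ "p * ?z"]) (simp_all add: add.commute)
      qed
      have "\<forall>p\<in>maximal_ideal_power e. scale p (scale ?z f) \<in> span (set gs) \<longleftrightarrow> p \<in> ideal L"
      proof
        fix p :: "('x, 'k) mpoly" assume "p \<in> maximal_ideal_power e"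
        then have "scale p (scale ?z f) \<in> span (set gs) \<longleftrightarrow> p * ?z \<in> ideal L"
          unfolding scale_scale using colon maximal_ideal_power_mult_variable by blast
        also have "\<dots> \<longleftrightarrow> p \<in> ideal L"
          using linear_form_nonzerodivisor_modulo[OF L variable_linear x] poly_ideal.span_scale[of p L ?z]
          by (metis mult.commute)
        finally show "scale p (scale ?z f) \<in> span (set gs) \<longleftrightarrow> p \<in> ideal L" .
      qed
      from outer[OF lq L this] obtain gs1 where gs1: "linear_quotient_list scale gs1"
        "set gs1 \<subseteq> set gs \<union> ?T" "span (set gs1) = span (set gs \<union> ?T)" by blast
      have gs_gs1: "span (set gs) \<subseteq> span (set gs1)"
        unfolding gs1(3) by (rule span_mono) simp
      have L': "insert ?z L \<subseteq> linear_forms" using L by simp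
      have smaller: "card {y. variable y \<notin> ideal (insert ?z L)} < card {y. variable y \<notin> ideal L}"
      proof (rule psubset_card_mono)
        show "{y. variable y \<notin> ideal (insert ?z L)} \<subset> {y. variable y \<notin> ideal L}"
          using x poly_ideal.span_base[of ?z "insert ?z L"] ideal_insert_mono by blast
      qed simp
      have colon': "\<forall>p\<in>maximal_ideal_power (Suc e).
        scale p f \<in> span (set gs1) \<longleftrightarrow> p \<in> ideal (insert ?z L)"
      proof (intro ballI iffI)
        fix p :: "('x, 'k) mpoly"
        assume p: "p \<in> maximal_ideal_power (Suc e)" and "scale p f \<in> span (set gs1)"
        then obtain u q where "scale p f = u + scale q (scale ?z f)" "u \<in> span (set gs)"
          "q \<in> maximal_ideal_power e"
          unfolding gs1(3) span_Un span_image_scale by blast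
        then have "scale (p - q * ?z) f \<in> span (set gs)" "p - q * ?z \<in> maximal_ideal_power (Suc e)"
          using p maximal_ideal_power_mult_variable
          by (auto simp: scale_left_diff_distrib intro: poly_ideal.span_diff)
        then have "p - q * ?z \<in> ideal L" using colon by blast
        then show "p \<in> ideal (insert ?z L)" unfolding poly_ideal.span_insert by blast
      next
        \<comment> \<open>If \<open>p = r + k z\<close> with \<open>r \<in> (L)\<close>, then each component of \<open>p\<close> of degree \<open>d > e\<close> has this form too,
          with \<open>r\<close> and \<open>k z\<close> homogeneous of degree \<open>d\<close>; then \<open>r\<close> lies in \<open>\<mm>\<^bsup>e+1\<^esup>\<close> and \<open>k\<close> in \<open>\<mm>\<^sup>e\<close>.\<close>
        fix p :: "('x, 'k) mpoly"
        assume p: "p \<in> maximal_ideal_power (Suc e)" "p \<in> ideal (insert ?z L)"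
        have "scale (hcomp d p) f \<in> span (set gs1)" for d
        proof (cases "d < int (Suc e)")
          case True
          then show ?thesis using hcomp_maximal_ideal_power[OF p(1)] by (simp add: span_zero)
        next
          case False
          obtain k where "p - k * ?z \<in> ideal L" using p(2) unfolding poly_ideal.span_insert by blast
          from hcomp_in_ideal[OF L this, of d]
          have r: "hcomp d p - hcomp (d - 1) k * ?z \<in> ideal L"
            using hcomp_mult[OF variable_linear, of d k x] hcomp_add[of d "p - k * ?z" "k * ?z"]
            by (simp add: algebra_simps)
          have k: "hcomp (d - 1) k \<in> maximal_ideal_power e"
            using False by (intro homogeneous_in_maximal_ideal_power[OF hcomp_homogeneous]) simp
          have "hcomp d p \<in> maximal_ideal_power (Suc e)"
            using False by (intro homogeneous_in_maximal_ideal_power[OF hcomp_homogeneous]) simp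
          then have "hcomp d p - hcomp (d - 1) k * ?z \<in> maximal_ideal_power (Suc e)"
            using maximal_ideal_power_mult_variable[OF k] poly_ideal.span_diff by blast
          then have "scale (hcomp d p - hcomp (d - 1) k * ?z) f \<in> span (set gs1)"
            using r colon gs_gs1 by blast
          moreover have "scale (hcomp (d - 1) k) (scale ?z f) \<in> span (set gs1)"
            unfolding gs1(3) using k span_mono[of ?T "set gs \<union> ?T"] span_image_scale by blast
          ultimately have "scale (hcomp d p - hcomp (d - 1) k * ?z) f
              + scale (hcomp (d - 1) k) (scale ?z f) \<in> span (set gs1)" by (rule span_add)
          then show ?thesis by (simp add: scale_left_diff_distrib)
        qed
        then have "(\<Sum>d\<in>degrees p. scale (hcomp d p) f) \<in> span (set gs1)" by (intro span_sum)
        then show "scale p f \<in> span (set gs1)"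
          by (simp add: sum_hcomp flip: scale_sum_left)
      qed
      from less.hyps[OF smaller gs1(1) L' colon'] obtain gs2 where gs2:
        "linear_quotient_list scale gs2" "set gs2 \<subseteq> set gs1 \<union> ?S"
        "span (set gs2) = span (set gs1 \<union> ?S)" by blast
      have "span (set gs1 \<union> ?S) = span (set gs \<union> ?S)"
      proof (intro span_eq[THEN iffD2] conjI)
        show "set gs1 \<union> ?S \<subseteq> span (set gs \<union> ?S)"
          using gs1(2) TS span_superset[of "set gs \<union> ?S"] by blast
        show "set gs \<union> ?S \<subseteq> span (set gs1 \<union> ?S)"
          using gs_gs1 span_superset[of "set gs"] span_superset[of "set gs1 \<union> ?S"]
            span_mono[of "set gs1" "set gs1 \<union> ?S"] by blast
      qed
      moreover have "set gs2 \<subseteq> set gs \<union> ?S" using gs2(2) gs1(2) TS by blast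
      ultimately show ?thesis using gs2(1,3) by auto
    qed
  qed
  then show ?case .
qed

end

section \<open>Components in graded modules\<close>

sublocale graded_module \<subseteq> polynomial_module ..

context graded_module begin

definition homogeneous_part :: "int \<Rightarrow> 'm \<Rightarrow> 'm" where
  "homogeneous_part d v = (THE c. finite {d. c d \<noteq> 0} \<and> (\<forall>d. c d \<in> component d) \<and> v = (\<Sum>d | c d \<noteq> 0. c d)) d"

lemma component_scale_hcomp:
  "u \<in> component e \<Longrightarrow> scale (hcomp (d - e) p) u \<in> component d"
  using scale_in_component[OF hcomp_homogeneous, of u e "d - e" p] by simp

lemma component_sum: "(\<And>i. i \<in> A \<Longrightarrow> h i \<in> component d) \<Longrightarrow> sum h A \<in> component d"
  by (induction A rule: infinite_finite_induct) (simp_all add: zero_in_component add_in_component)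

text \<open>
  The right-hand sides, for all \<open>d\<close>, form a decomposition of the sum into homogeneous elements, and
  such decompositions are unique. Relations with arbitrary coefficients thereby reduce to
  relations with homogeneous ones.
\<close>

lemma homogeneous_part_sum:
  assumes "finite A" and h: "\<And>i. i \<in> A \<Longrightarrow> h i \<in> component (e i)"
  shows "homogeneous_part d (\<Sum>i\<in>A. scale (q i) (h i)) = (\<Sum>i\<in>A. scale (hcomp (d - e i) (q i)) (h i))"
proof -
  define w where "w d = (\<Sum>i\<in>A. scale (hcomp (d - e i) (q i)) (h i))" for d
  define E where "E = (\<Union>i\<in>A. (\<lambda>s. s + e i) ` degrees (q i))"
  have E: "finite E" using assms(1) by (simp add: E_def)
  have supp: "{d. w d \<noteq> 0} \<subseteq> E"
  proof
    fix d assume "d \<in> {d. w d \<noteq> 0}"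
    then obtain i where i: "i \<in> A" "scale (hcomp (d - e i) (q i)) (h i) \<noteq> 0"
      unfolding w_def by (auto elim: sum.not_neutral_contains_not_neutral)
    then have "d - e i \<in> degrees (q i)" using hcomp_notin_degrees by fastforce
    then have "d \<in> (\<lambda>s. s + e i) ` degrees (q i)" by (intro image_eqI[of _ _ "d - e i"]) auto
    then show "d \<in> E" using i(1) by (auto simp: E_def)
  qed
  have total: "(\<Sum>d\<in>E. hcomp (d - e i) (q i)) = q i" if "i \<in> A" for i
  proof -
    have "(\<Sum>d\<in>E. hcomp (d - e i) (q i)) = (\<Sum>s\<in>(\<lambda>d. d - e i) ` E. hcomp s (q i))"
      by (subst sum.reindex) (auto simp: inj_on_def)
    also have "\<dots> = q i"
    proof (rule sum_hcomp)
      show "degrees (q i) \<subseteq> (\<lambda>d. d - e i) ` E"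
        using that unfolding E_def by force
    qed (use E in simp)
    finally show ?thesis .
  qed
  have "(\<Sum>d | w d \<noteq> 0. w d) = (\<Sum>d\<in>E. w d)"
    using supp E by (intro sum.mono_neutral_left) auto
  also have "\<dots> = (\<Sum>i\<in>A. \<Sum>d\<in>E. scale (hcomp (d - e i) (q i)) (h i))"
    unfolding w_def by (rule sum.swap)
  also have "\<dots> = (\<Sum>i\<in>A. scale (q i) (h i))"
    by (rule sum.cong) (simp_all add: total flip: scale_sum_left)
  finally have sum: "(\<Sum>d | w d \<noteq> 0. w d) = (\<Sum>i\<in>A. scale (q i) (h i))" .
  have "finite {d. w d \<noteq> 0} \<and> (\<forall>d. w d \<in> component d) \<and>
      (\<Sum>i\<in>A. scale (q i) (h i)) = (\<Sum>d | w d \<noteq> 0. w d)"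
    using finite_subset[OF supp E] sum h by (auto simp: w_def intro!: component_sum component_scale_hcomp)
  then have "(THE c. finite {d. c d \<noteq> 0} \<and> (\<forall>d. c d \<in> component d) \<and>
      (\<Sum>i\<in>A. scale (q i) (h i)) = (\<Sum>d | c d \<noteq> 0. c d)) = w"
    by (intro the1_equality direct_sum_decomposition)
  then show ?thesis by (simp add: homogeneous_part_def w_def)
qed

lemma homogeneous_part_scale:
  assumes "u \<in> component e" shows "homogeneous_part d (scale p u) = scale (hcomp (d - e) p) u"
  using homogeneous_part_sum[of "{()}" "\<lambda>_. u" "\<lambda>_. e" d "\<lambda>_. p"] assms by simp

lemma homogeneous_part_zero: "homogeneous_part d 0 = 0"
  using homogeneous_part_sum[of "{}"] by simp

lemma graded_relations_same_degree:
  assumes "set gs \<subseteq> component k" shows "graded_relations gs"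
  unfolding graded_relations_def
proof (intro allI impI)
  fix v d assume v: "free_eval scale (length gs) ((!) gs) v = 0"
  have "homogeneous_part (d + k) (free_eval scale (length gs) ((!) gs) v)
      = free_eval scale (length gs) ((!) gs) (\<lambda>l. hcomp d (v l))"
    unfolding free_eval_def using assms
    by (subst homogeneous_part_sum[where e = "\<lambda>_. k"]) auto
  then show "free_eval scale (length gs) ((!) gs) (\<lambda>l. hcomp d (v l)) = 0"
    by (simp add: v homogeneous_part_zero)
qed

end

section \<open>Generators of the degree submodules\<close>

text \<open>
  The assumptions of the theorem, collected so that the submodules in its proof can be named.
\<close>

locale linear_quotient_generators = graded_module scale component
  for scale :: "('x::finite, 'k::field) mpoly \<Rightarrow> 'm::ab_group_add \<Rightarrow> 'm" and component +
  fixes f :: "nat \<Rightarrow> 'm" and m :: nat and deg :: "nat \<Rightarrow> int"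
  assumes linear_quotients: "has_linear_quotients scale f m"
    and homogeneous: "j \<in> {1..m} \<Longrightarrow> f j \<in> component (deg j)"
    and degree_mono: "i \<in> {1..m} \<Longrightarrow> j \<in> {1..m} \<Longrightarrow> i \<le> j \<Longrightarrow> deg i \<le> deg j"
begin

text \<open>
  The elements of \<open>(f\<^sub>1, \<dots>, f\<^sub>j)\<close> that have no component of degree below \<open>k\<close>, provided that all degrees
  are at most \<open>k\<close>. A generator of degree above \<open>k\<close> contributes nothing, as forms of
  negative degree vanish.
\<close>

definition truncation :: "int \<Rightarrow> nat \<Rightarrow> 'm set" where
  "truncation k j = span (\<Union>i\<in>{1..j}. (\<lambda>p. scale p (f i)) ` homogeneous_polys (k - deg i))"

lemma scale_generator_in_truncation:
  "i \<in> {1..j} \<Longrightarrow> p \<in> homogeneous_polys (k - deg i) \<Longrightarrow> scale p (f i) \<in> truncation k j"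
  unfolding truncation_def by (blast intro: span_base)

lemma truncation_subset: "truncation k j \<subseteq> span (f ` {1..j})"
  unfolding truncation_def by (rule span_minimal) (auto intro: span_scale span_base)

lemma truncation_Suc:
  "truncation k (Suc j) =
    span (truncation k j \<union> (\<lambda>p. scale p (f (Suc j))) ` homogeneous_polys (k - deg (Suc j)))"
proof -
  have "{1..Suc j} = insert (Suc j) {1..j}" by auto
  then show ?thesis
    unfolding truncation_def
    by (auto simp: span_Un span_span Un_commute)
qed

text \<open>
  Truncation does not change colon ideals. In a relation \<open>p f\<^bsub>j+1\<^esub> = q\<^sub>1 f\<^sub>1 + \<dots> + q\<^sub>j f\<^sub>j\<close> take the component
  of a degree \<open>d \<ge> k\<close>: the coefficient of \<open>f\<^sub>i\<close> becomes homogeneous of degree \<open>d - deg i \<ge> k - deg i\<close>.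
  Since \<open>deg i \<le> deg (j + 1) \<le> k\<close>, the number \<open>k - deg i\<close> is not negative, so that the coefficient
  lies in \<open>\<mm>\<^bsup>k - deg i\<^esup>\<close> and the right-hand side in the truncation. It is here that the order of the
  generators by degree enters.
\<close>

lemma scale_in_truncation_iff:
  assumes j: "Suc j \<in> {1..m}" and k: "deg (Suc j) \<le> k"
    and p: "p \<in> maximal_ideal_power (nat (k - deg (Suc j)))"
  shows "scale p (f (Suc j)) \<in> truncation k j \<longleftrightarrow> p \<in> colon_ideal scale f (Suc j)"
proof
  have colon: "colon_ideal scale f (Suc j) = {g. scale g (f (Suc j)) \<in> span (f ` {1..j})}"
    unfolding colon_ideal_def atLeastLessThanSuc_atLeastAtMost ..
  show "p \<in> colon_ideal scale f (Suc j)" if "scale p (f (Suc j)) \<in> truncation k j"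
    using that truncation_subset unfolding colon by blast
  assume "p \<in> colon_ideal scale f (Suc j)"
  then have "scale p (f (Suc j)) \<in> span (f ` {1..j})"
    unfolding colon by simp
  then obtain q where q: "scale p (f (Suc j)) = (\<Sum>i\<in>{1..j}. scale (q i) (f i))"
    using span_image_finite by blast
  have "scale (hcomp s p) (f (Suc j)) \<in> truncation k j" for s
  proof (cases "s < k - deg (Suc j)")
    case True
    then show ?thesis
      using hcomp_maximal_ideal_power[OF p, of s] k by (simp add: truncation_def span_zero)
  next
    case False
    define d where "d = s + deg (Suc j)"
    have "scale (hcomp s p) (f (Suc j)) = homogeneous_part d (scale p (f (Suc j)))"
      using homogeneous_part_scale[OF homogeneous[OF j]] by (simp add: d_def)
    also have "\<dots> = (\<Sum>i\<in>{1..j}. scale (hcomp (d - deg i) (q i)) (f i))"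
      unfolding q using j by (intro homogeneous_part_sum) (auto intro: homogeneous)
    also have "\<dots> \<in> truncation k j"
      unfolding truncation_def
    proof (rule span_sum)
      fix i assume i: "i \<in> {1..j}"
      then have "deg i \<le> k" using degree_mono[of i "Suc j"] j k by auto
      then have "hcomp (d - deg i) (q i) \<in> maximal_ideal_power (nat (k - deg i))"
        using False by (intro homogeneous_in_maximal_ideal_power[OF hcomp_homogeneous]) (simp add: d_def)
      then have "scale (hcomp (d - deg i) (q i)) (f i)
          \<in> span ((\<lambda>p. scale p (f i)) ` homogeneous_polys (k - deg i))"
        using \<open>deg i \<le> k\<close> unfolding span_image_scale by simp
      then show "scale (hcomp (d - deg i) (q i)) (f i)
          \<in> span (\<Union>i\<in>{1..j}. (\<lambda>p. scale p (f i)) ` homogeneous_polys (k - deg i))"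
        using i span_mono[of "(\<lambda>p. scale p (f i)) ` homogeneous_polys (k - deg i)"
          "\<Union>i\<in>{1..j}. (\<lambda>p. scale p (f i)) ` homogeneous_polys (k - deg i)"] by blast
    qed
    finally show ?thesis .
  qed
  then have "(\<Sum>s\<in>degrees p. scale (hcomp s p) (f (Suc j))) \<in> truncation k j"
    unfolding truncation_def by (intro span_sum)
  then show "scale p (f (Suc j)) \<in> truncation k j"
    by (simp add: sum_hcomp flip: scale_sum_left)
qed

text \<open>
  Going from \<open>j\<close> to \<open>j + 1\<close> adds \<open>\<mm>\<^bsup>k - deg (j+1)\<^esup> f\<^bsub>j+1\<^esub>\<close>. This is redundant if \<open>deg (j + 1) > k\<close> or if
  the colon ideal is the whole ring; otherwise \<open>truncated_cyclic_extension\<close> provides the new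
  generators.
\<close>

lemma truncation_generators:
  "j \<le> m \<Longrightarrow> \<exists>gs. linear_quotient_list scale gs \<and> set gs \<subseteq> component k \<and> span (set gs) = truncation k j"
proof (induction j)
  case 0
  show ?case
    by (intro exI[of _ "[]"]) (simp add: truncation_def linear_quotient_list.Nil)
next
  case (Suc j)
  then obtain gs where gs: "linear_quotient_list scale gs" "set gs \<subseteq> component k"
    "span (set gs) = truncation k j" by auto
  have j: "Suc j \<in> {1..m}" using Suc.prems by simp
  let ?S = "(\<lambda>p. scale p (f (Suc j))) ` homogeneous_polys (k - deg (Suc j))"
  have S: "?S \<subseteq> component k"
    using scale_in_component[OF _ homogeneous[OF j], of _ "k - deg (Suc j)"] by auto
  have trunc: "truncation k (Suc j) = span (set gs \<union> ?S)"
    unfolding truncation_Suc gs(3)[symmetric] by (simp add: span_Un span_span)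
  have redundant: ?case if "?S \<subseteq> span (set gs)"
  proof -
    have "span (set gs \<union> ?S) = span (set gs)"
      using that span_superset[of "set gs"] span_superset[of "set gs \<union> ?S"]
      by (intro span_eq[THEN iffD2]) auto
    then show ?thesis using gs trunc by auto
  qed
  show ?case
  proof (cases "k < deg (Suc j)")
    case True
    then show ?thesis
      using homogeneous_negative[of "k - deg (Suc j)"] by (intro redundant) (force simp: span_zero)
  next
    case False
    let ?e = "nat (k - deg (Suc j))"
    have e: "int ?e = k - deg (Suc j)" using False by simp
    have colon: "\<forall>p\<in>maximal_ideal_power ?e.
        scale p (f (Suc j)) \<in> span (set gs) \<longleftrightarrow> p \<in> colon_ideal scale f (Suc j)"
      unfolding gs(3) using scale_in_truncation_iff[OF j] False by simp
    show ?thesis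
    proof (cases "colon_ideal scale f (Suc j) = UNIV")
      case True
      show ?thesis
      proof (rule redundant, rule image_subsetI)
        fix p :: "('x, 'k) mpoly" assume "p \<in> homogeneous_polys (k - deg (Suc j))"
        then have "p \<in> maximal_ideal_power ?e" unfolding e by (rule poly_ideal.span_base)
        then show "scale p (f (Suc j)) \<in> span (set gs)" using colon True by blast
      qed
    next
      case False
      then obtain L where L: "L \<subseteq> linear_forms" "colon_ideal scale f (Suc j) = ideal L"
        using linear_quotients j
        unfolding has_linear_quotients_def generated_by_linear_forms_def by blast
      from truncated_cyclic_extension[OF gs(1) L(1) colon[unfolded L(2)]]
      obtain gs' where gs': "linear_quotient_list scale gs'" "set gs' \<subseteq> set gs \<union> ?S"
        "span (set gs') = span (set gs \<union> ?S)" unfolding e by blast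
      then show ?thesis using gs(2) S trunc by blast
    qed
  qed
qed

lemma truncation_eq_degree_submodule: "truncation k m = degree_submodule scale component k"
  unfolding degree_submodule_def
proof (rule antisym)
  show "truncation k m \<subseteq> span (component k)"
    unfolding truncation_def
  proof (rule span_mono, rule UN_least, rule image_subsetI)
    fix i and p :: "('x, 'k) mpoly"
    assume i: "i \<in> {1..m}" and p: "p \<in> homogeneous_polys (k - deg i)"
    from scale_in_component[OF p homogeneous[OF i]] show "scale p (f i) \<in> component k" by simp
  qed
  have "component k \<subseteq> truncation k m"
  proof
    fix v assume v: "v \<in> component k"
    have "v \<in> span (f ` {1..m})" using linear_quotients by (simp add: has_linear_quotients_def)
    then obtain q where q: "v = (\<Sum>i\<in>{1..m}. scale (q i) (f i))"
      using span_image_finite by blast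
    have "hcomp 0 1 = (1 :: ('x, 'k) mpoly)"
      using hcomp_of_homogeneous[OF homogeneous_const[of 1], of 0] by simp
    then have "v = homogeneous_part k v" using homogeneous_part_scale[OF v, of k 1] by simp
    also have "\<dots> = (\<Sum>i\<in>{1..m}. scale (hcomp (k - deg i) (q i)) (f i))"
      unfolding q by (intro homogeneous_part_sum) (auto intro: homogeneous)
    also have "\<dots> \<in> truncation k m"
      using scale_generator_in_truncation[of _ m _ k] unfolding truncation_def by (intro span_sum) auto
    finally show "v \<in> truncation k m" .
  qed
  then show "span (component k) \<subseteq> truncation k m"
    unfolding truncation_def by (intro span_minimal) auto
qed

end

section \<open>Componentwise linearity\<close>

theorem proposition1p1:
  fixes scale :: "('x::finite, 'k::field) mpoly \<Rightarrow> 'm::ab_group_add \<Rightarrow> 'm"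
    and component :: "int \<Rightarrow> 'm set"
    and f :: "nat \<Rightarrow> 'm" and m :: nat and deg :: "nat \<Rightarrow> int"
  assumes "graded_module scale component"
    and "has_linear_quotients scale f m"
    and "\<forall>j\<in>{1..m}. f j \<in> component (deg j)"
    and "\<forall>i\<in>{1..m}. \<forall>j\<in>{1..m}. i \<le> j \<longrightarrow> deg i \<le> deg j"
  shows "componentwise_linear scale component"
proof -
  interpret linear_quotient_generators scale component f m deg
    using assms by (intro linear_quotient_generators.intro linear_quotient_generators_axioms.intro) auto
  have "has_linear_resolution scale component (degree_submodule scale component k)" for k
  proof -
    obtain gs where gs: "linear_quotient_list scale gs" "set gs \<subseteq> component k"
      "span (set gs) = truncation k m"
      using truncation_generators[of m k] by blast
    then have "has_linear_resolution scale component (span (set gs))"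
      using linear_quotient_list_resolution graded_relations_same_degree by blast
    then show ?thesis unfolding gs(3) truncation_eq_degree_submodule .
  qed
  then show ?thesis by (simp add: componentwise_linear_def)
qed

end
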